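(* Let $p\ge 2$ and $r\ge 1$ be integers. Suppose $(A_{j1},\dots,A_{jp})$, for $j=1,\dots,m$, are $m$ distinct weak set compositions into $p$ parts such that for every $k\in[p]$ and every $I\subseteq[m]$ with $|I|=r+1$ there exist distinct $i,j\in I$ such that either $A_{ik}=A_{jk}$ or \[ A_{ik}\cap \bigcup_{l\neq k} A_{jl}\neq\emptyset\neq A_{jk}\cap\bigcup_{l\neq k}A_{il}. \] Then \[ \sum_{j=1}^m \frac{1}{\binom{|A_{j1}|+\dots+|A_{jp}|}{|A_{j1}|,\dots,|A_{jp}|}}\le r^p . \]
   Context: A weak set composition into $p$ parts is an ordered $p$-tuple $(A_1,\dots,A_p)$ of pairwise disjoint finite sets, each possibly empty. $[p]=\{1,\dots,p\}$. $\binom{a_1+\dots+a_p}{a_1,\dots,a_p}$ denotes the multinomial coefficient $\frac{(a_1+\dots+a_p)!}{a_1!\cdots a_p!}$. *)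

theory Defs
  imports Complex_Main "HOL-Library.Disjoint_Sets" "HOL-Library.FuncSet"
begin

text \<open>A \<open>p\<close>-tuple of sets is a function on \<open>nat\<close> of which only the values on \<open>{1..p}\<close> matter.\<close>

definition weak_set_composition :: "nat \<Rightarrow> (nat \<Rightarrow> 'a set) \<Rightarrow> bool" where
  "weak_set_composition p A \<longleftrightarrow>
     (\<forall>k\<in>{1..p}. finite (A k)) \<and> disjoint_family_on A {1..p}"

definition multinomial :: "nat \<Rightarrow> (nat \<Rightarrow> nat) \<Rightarrow> real" where
  "multinomial p a = fact (\<Sum>k=1..p. a k) / (\<Prod>k=1..p. fact (a k))"

end

theory Submission
  imports Defs "HOL-Combinatorics.Multiset_Permutations"
begin

text \<open>
  Fix a finite ground set containing all the parts. A linear order of it separates a composition if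
  all elements of each part precede all elements of every later part; a uniformly random order does
  so with probability equal to the reciprocal of the multinomial coefficient. It remains to see that
  a single order separates at most \<open>r ^ p\<close> of the given compositions. If two separated
  compositions agree in the parts before the \<open>k\<close>-th, then the \<open>k\<close>-th part of one can meet only
  later parts of the other, so the two-sided intersection condition for \<open>k\<close> would force two
  elements to precede each other. Hence each choice of the first \<open>k - 1\<close> parts admits at
  most \<open>r\<close> choices of the \<open>k\<close>-th.
\<close>

section \<open>Counting the linear orders that separate a composition\<close>

definition part_le :: "nat \<Rightarrow> (nat \<Rightarrow> 'a set) \<Rightarrow> 'a \<Rightarrow> 'a \<Rightarrow> bool" where
  "part_le p A x y \<longleftrightarrow> (\<forall>k\<in>{1..p}. \<forall>l\<in>{1..p}. x \<in> A k \<longrightarrow> y \<in> A l \<longrightarrow> k \<le> l)"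

text \<open>Elements outside all parts are \<open>part_le\<close>-related to everything in both
  directions, so \<open>part_le\<close> need not be transitive; \<open>sorted_wrt\<close> constrains
  all pairs, not only neighbours.\<close>

definition separates :: "nat \<Rightarrow> (nat \<Rightarrow> 'a set) \<Rightarrow> 'a list \<Rightarrow> bool" where
  "separates p A xs \<longleftrightarrow> sorted_wrt (part_le p A) xs"

lemma separates_Cons:
  "separates p A (x # xs) \<longleftrightarrow> (\<forall>y\<in>set xs. part_le p A x y) \<and> separates p A xs"
  by (simp add: separates_def)

definition separating_orders :: "nat \<Rightarrow> (nat \<Rightarrow> 'a set) \<Rightarrow> 'a set \<Rightarrow> 'a list set" where
  "separating_orders p A S = {xs \<in> permutations_of_set S. separates p A xs}"

lemma finite_separating_orders [simp]: "finite (separating_orders p A S)"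
  by (simp add: separating_orders_def)

text \<open>Orders are classified by their head \<open>x\<close>: it must be allowed before
  everything else, and the tail is then any separating order of \<open>S - {x}\<close>.\<close>

lemma card_separating_orders_rec:
  assumes "finite S" "S \<noteq> {}"
  shows "card (separating_orders p A S) =
    (\<Sum>x\<in>{x\<in>S. \<forall>y\<in>S - {x}. part_le p A x y}. card (separating_orders p A (S - {x})))"
proof -
  let ?X = "{x\<in>S. \<forall>y\<in>S - {x}. part_le p A x y}"
  have "separating_orders p A S = (\<Union>x\<in>?X. (#) x ` separating_orders p A (S - {x}))"
  proof (intro equalityI subsetI)
    fix xs assume "xs \<in> separating_orders p A S"
    then show "xs \<in> (\<Union>x\<in>?X. (#) x ` separating_orders p A (S - {x}))"
      using assms(2)
      by (cases xs) (auto simp: separating_orders_def permutations_of_set_def separates_Cons)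
  next
    fix xs assume "xs \<in> (\<Union>x\<in>?X. (#) x ` separating_orders p A (S - {x}))"
    then show "xs \<in> separating_orders p A S"
      by (auto simp: separating_orders_def permutations_of_set_def separates_Cons)
  qed
  also have "card \<dots> = (\<Sum>x\<in>?X. card ((#) x ` separating_orders p A (S - {x})))"
    using assms(1) by (intro card_UN_disjoint) auto
  also have "\<dots> = (\<Sum>x\<in>?X. card (separating_orders p A (S - {x})))"
    by (intro sum.cong refl card_image) (auto simp: inj_on_def)
  finally show ?thesis .
qed

lemma disjoint_family_on_unique:
  assumes "disjoint_family_on A I" "k \<in> I" "l \<in> I" "x \<in> A k" "x \<in> A l"
  shows "k = l"
  using assms unfolding disjoint_family_on_def by blast

text \<open>The reciprocal of the multinomial coefficient for the traces of the parts on
  \<open>S\<close>. Taking traces lets \<open>S\<close> shrink in an induction while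
  \<open>A\<close> stays fixed.\<close>

definition part_weight :: "nat \<Rightarrow> (nat \<Rightarrow> 'a set) \<Rightarrow> 'a set \<Rightarrow> real" where
  "part_weight p A S = (\<Prod>k=1..p. fact (card (A k \<inter> S))) / fact (\<Sum>k=1..p. card (A k \<inter> S))"

lemma part_weight_remove_outside:
  assumes "\<And>k. k \<in> {1..p} \<Longrightarrow> x \<notin> A k"
  shows "part_weight p A (S - {x}) = part_weight p A S"
proof -
  have "A k \<inter> (S - {x}) = A k \<inter> S" if "k \<in> {1..p}" for k
    using assms[OF that] by auto
  then show ?thesis by (simp add: part_weight_def)
qed

text \<open>Only one numerator factorial and the factorial in the denominator change, each losing
  its top factor; these factors are the two multipliers.\<close>

lemma part_weight_remove_inside:
  assumes "finite S" "disjoint_family_on A {1..p}" "k \<in> {1..p}" "x \<in> A k" "x \<in> S"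
  shows "real (card (A k \<inter> S)) * part_weight p A (S - {x}) =
         real (\<Sum>k=1..p. card (A k \<inter> S)) * part_weight p A S"
proof -
  have rest: "A l \<inter> (S - {x}) = A l \<inter> S" if "l \<in> {1..p} - {k}" for l
    using disjoint_family_on_unique[OF assms(2,3) _ assms(4)] that by blast
  obtain a where a: "card (A k \<inter> S) = Suc a" "card (A k \<inter> (S - {x})) = a"
  proof
    have "A k \<inter> S = insert x (A k \<inter> (S - {x}))"
      using assms by auto
    then show "card (A k \<inter> S) = Suc (card (A k \<inter> (S - {x})))"
      using assms(1) by (metis Diff_iff IntD2 card_insert_disjoint finite_Diff finite_Int insertI1)
  qed simp
  define b where "b = (\<Sum>l\<in>{1..p} - {k}. card (A l \<inter> S))"
  define c :: real where "c = (\<Prod>l\<in>{1..p} - {k}. fact (card (A l \<inter> S)))"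
  have "(\<Sum>k=1..p. card (A k \<inter> S)) = Suc a + b"
       "(\<Sum>l=1..p. card (A l \<inter> (S - {x}))) = a + b"
    using assms(3) by (simp_all add: sum.remove[of _ k] a b_def rest)
  moreover have "(\<Prod>k=1..p. fact (card (A k \<inter> S))) = fact (Suc a) * c"
       "(\<Prod>l=1..p. fact (card (A l \<inter> (S - {x})))) = fact a * c"
    using assms(3) by (simp_all add: prod.remove[of _ k] a c_def rest)
  ultimately show ?thesis
    unfolding part_weight_def a by (simp add: divide_simps del: of_nat_Suc)
qed

text \<open>Induction on \<open>S\<close> through the head of the order. With \<open>T\<close> the
  union of the traces, heads outside \<open>T\<close> contribute \<open>card S - card T\<close>
  times the weight and heads inside \<open>T\<close> contribute \<open>card T\<close> times, which
  adds up to \<open>card S\<close>.\<close>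

lemma card_separating_orders:
  assumes "finite S" "disjoint_family_on A {1..p}"
  shows "real (card (separating_orders p A S)) = fact (card S) * part_weight p A S"
  using assms(1)
proof (induction S rule: finite_psubset_induct)
  case (psubset S)
  show ?case
  proof (cases "S = {}")
    case True
    then show ?thesis
      by (simp add: separating_orders_def separates_def part_weight_def Collect_conv_if)
  next
    case False
    define n where "n = card S - 1"
    have n: "card S = Suc n"
      using False psubset.hyps by (simp add: n_def card_gt_0_iff)
    define T where "T = (\<Union>k\<in>{1..p}. A k \<inter> S)"
    define X where "X = {x\<in>S. \<forall>y\<in>S - {x}. part_le p A x y}"
    have T: "finite T" "T \<subseteq> S"
      using psubset.hyps by (auto simp: T_def)
    have cardT: "card T = (\<Sum>k=1..p. card (A k \<inter> S))"
      unfolding T_def using psubset.hyps assms(2)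
      by (intro card_UN_disjoint) (auto simp: disjoint_family_on_def)
    have outside: "S - T \<subseteq> X"
      by (auto simp: X_def T_def part_le_def)
    have weight_outside: "(\<Sum>x\<in>S - T. part_weight p A (S - {x})) =
        real (card S - card T) * part_weight p A S"
    proof -
      have "part_weight p A (S - {x}) = part_weight p A S" if "x \<in> S - T" for x
        using that by (intro part_weight_remove_outside) (auto simp: T_def)
      then show ?thesis
        using T by (simp add: card_Diff_subset)
    qed
    have weight_inside: "(\<Sum>x\<in>X \<inter> T. part_weight p A (S - {x})) =
        real (card T) * part_weight p A S"
    proof (cases "T = {}")
      case True
      then show ?thesis by simp
    next
      case nonempty: False
      \<comment> \<open>The first part that meets \<open>S\<close>: the possible heads inside
        \<open>T\<close> are exactly its elements in \<open>S\<close>.\<close>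
      define k where "k = (LEAST k. k \<in> {1..p} \<and> A k \<inter> S \<noteq> {})"
      have ex: "\<exists>k. k \<in> {1..p} \<and> A k \<inter> S \<noteq> {}"
        using nonempty by (auto simp: T_def)
      have k: "k \<in> {1..p}" "A k \<inter> S \<noteq> {}"
        using LeastI_ex[OF ex] by (auto simp: k_def)
      have least: "k \<le> l" if "l \<in> {1..p}" "A l \<inter> S \<noteq> {}" for l
        unfolding k_def using that by (intro Least_le) auto
      have "X \<inter> T = A k \<inter> S"
      proof (intro equalityI subsetI)
        fix x assume x: "x \<in> X \<inter> T"
        then obtain l where l: "l \<in> {1..p}" "x \<in> A l" by (auto simp: T_def)
        obtain y where y: "y \<in> A k" "y \<in> S" using k by auto
        have "l \<le> k" if "x \<noteq> y"
          using x l y k(1) that unfolding X_def part_le_def by blast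
        moreover have "k \<le> l"
          using x l by (intro least) (auto simp: X_def)
        ultimately show "x \<in> A k \<inter> S"
          using x l y by (cases "x = y") (auto simp: X_def)
      next
        fix x assume x: "x \<in> A k \<inter> S"
        have "l = k" if "l \<in> {1..p}" "x \<in> A l" for l
          using disjoint_family_on_unique[OF assms(2) that(1) k(1) that(2)] x by blast
        then show "x \<in> X \<inter> T"
          using x k(1) least unfolding X_def T_def part_le_def by blast
      qed
      moreover have "real (card (A k \<inter> S)) * part_weight p A (S - {x}) =
          real (card T) * part_weight p A S" if "x \<in> A k \<inter> S" for x
        using part_weight_remove_inside[OF psubset.hyps assms(2) k(1)] that by (simp add: cardT)
      moreover have "card (A k \<inter> S) \<noteq> 0"
        using k psubset.hyps by simp
      \<comment> \<open>All \<open>card (A k \<inter> S)\<close> summands are equal, so the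
        denominator cancels on summation.\<close>
      ultimately have "part_weight p A (S - {x}) =
          real (card T) * part_weight p A S / real (card (A k \<inter> S))" if "x \<in> X \<inter> T" for x
        using that by (simp add: field_simps)
      then show ?thesis
        using \<open>X \<inter> T = A k \<inter> S\<close> \<open>card (A k \<inter> S) \<noteq> 0\<close> by simp
    qed
    have "real (card (separating_orders p A S)) =
        (\<Sum>x\<in>X. real (card (separating_orders p A (S - {x}))))"
      using psubset.hyps False by (simp add: card_separating_orders_rec X_def)
    also have "\<dots> = (\<Sum>x\<in>X. fact n * part_weight p A (S - {x}))"
    proof (intro sum.cong refl)
      fix x assume "x \<in> X"
      then have "x \<in> S" by (simp add: X_def)
      then show "real (card (separating_orders p A (S - {x}))) = fact n * part_weight p A (S - {x})"
        using psubset.IH[of "S - {x}"] n by auto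
    qed
    also have "\<dots> = fact n * (\<Sum>x\<in>(S - T) \<union> (X \<inter> T). part_weight p A (S - {x}))"
    proof -
      have "X = (S - T) \<union> (X \<inter> T)"
        using outside by (auto simp: X_def)
      then show ?thesis
        by (simp add: sum_distrib_left)
    qed
    also have "(\<Sum>x\<in>(S - T) \<union> (X \<inter> T). part_weight p A (S - {x})) =
        real (card S) * part_weight p A S"
    proof -
      have "card T \<le> card S"
        using T psubset.hyps by (simp add: card_mono)
      moreover have "(\<Sum>x\<in>(S - T) \<union> (X \<inter> T). part_weight p A (S - {x})) =
          (\<Sum>x\<in>S - T. part_weight p A (S - {x})) + (\<Sum>x\<in>X \<inter> T. part_weight p A (S - {x}))"
        using psubset.hyps T by (intro sum.union_disjoint) auto
      ultimately show ?thesis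
        unfolding weight_outside weight_inside by (simp add: of_nat_diff algebra_simps)
    qed
    finally show ?thesis
      by (simp add: n algebra_simps)
  qed
qed

section \<open>Compositions separated by a common order\<close>

lemma sorted_wrt_comparable:
  assumes "sorted_wrt P xs" "sorted_wrt Q xs" "x \<in> set xs" "y \<in> set xs" "x \<noteq> y"
  shows "P x y \<and> Q x y \<or> P y x \<and> Q y x"
  using assms by (induction xs) auto

text \<open>Take \<open>x\<close> in \<open>A k\<close> and \<open>B l\<close>, and \<open>y\<close>
  in \<open>B k\<close> and \<open>A l'\<close>. Agreement below \<open>k\<close> and disjointness
  force \<open>l\<close> and \<open>l'\<close> above \<open>k\<close>. Then \<open>B\<close> forbids
  \<open>x\<close> before \<open>y\<close>, and \<open>A\<close> forbids \<open>y\<close> before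
  \<open>x\<close>.\<close>

lemma separates_not_crossing:
  assumes "separates p A xs" "separates p B xs"
    and "disjoint_family_on A {1..p}" "disjoint_family_on B {1..p}"
    and "k \<in> {1..p}" "\<And>l. l \<in> {1..<k} \<Longrightarrow> A l = B l"
    and "A k \<subseteq> set xs" "B k \<subseteq> set xs"
    and "A k \<inter> (\<Union>l\<in>{1..p} - {k}. B l) \<noteq> {}" "B k \<inter> (\<Union>l\<in>{1..p} - {k}. A l) \<noteq> {}"
  shows False
proof -
  obtain x l where x: "x \<in> A k" "x \<in> B l" "l \<in> {1..p}" "l \<noteq> k"
    using assms(9) by blast
  obtain y l' where y: "y \<in> B k" "y \<in> A l'" "l' \<in> {1..p}" "l' \<noteq> k"
    using assms(10) by blast
  have "\<not> l < k"
    using x assms(6)[of l] disjoint_family_on_unique[OF assms(3,5) x(3,1)] by auto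
  moreover have "\<not> l' < k"
    using y assms(6)[of l'] disjoint_family_on_unique[OF assms(4,5) y(3,1)] by auto
  \<comment> \<open>If they were equal, the point would lie in both \<open>A k\<close> and
    \<open>A l'\<close>, against disjointness.\<close>
  moreover have "x \<noteq> y"
    using x y disjoint_family_on_unique[OF assms(3,5) y(3)] by blast
  then have "part_le p A x y \<and> part_le p B x y \<or> part_le p A y x \<and> part_le p B y x"
    using assms(1,2,7,8) x y unfolding separates_def by (intro sorted_wrt_comparable) auto
  then have "l \<le> k \<or> l' \<le> k"
    using x y assms(5) unfolding part_le_def by blast
  ultimately show False
    using x y by linarith
qed

text \<open>Fibrewise counting: each of the at most \<open>a\<close> first components extends by at
  most \<open>b\<close> second components.\<close>

lemma card_image_Pair_le:
  assumes "finite X" "card (f ` X) \<le> a" "\<And>x. x \<in> X \<Longrightarrow> card (h ` {z\<in>X. f z = f x}) \<le> b"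
  shows "card ((\<lambda>x. (f x, h x)) ` X) \<le> a * b"
proof -
  have "card ((\<lambda>x. (f x, h x)) ` X) \<le> card (SIGMA y:f ` X. h ` {z\<in>X. f z = y})"
    using assms(1) by (intro card_mono finite_SigmaI) auto
  also have "\<dots> = (\<Sum>y\<in>f ` X. card (h ` {z\<in>X. f z = y}))"
    using assms(1) by (intro card_SigmaI) auto
  also have "\<dots> \<le> card (f ` X) * b"
    using assms(3) by (intro sum_bounded_above[of _ _ b, simplified]) auto
  also have "\<dots> \<le> a * b"
    using assms(2) by simp
  finally show ?thesis .
qed

lemma card_separated_le:
  fixes A :: "'i \<Rightarrow> nat \<Rightarrow> 'a set"
  assumes "finite J"
    and wsc: "\<And>j. j \<in> J \<Longrightarrow> weak_set_composition p (A j)"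
    and inj: "inj_on (\<lambda>j. restrict (A j) {1..p}) J"
    and sep: "\<And>j. j \<in> J \<Longrightarrow> separates p (A j) xs"
    and sub: "\<And>j k. j \<in> J \<Longrightarrow> k \<in> {1..p} \<Longrightarrow> A j k \<subseteq> set xs"
    and cross: "\<And>k I. k \<in> {1..p} \<Longrightarrow> I \<subseteq> J \<Longrightarrow> card I = r + 1 \<Longrightarrow>
           \<exists>i\<in>I. \<exists>j\<in>I. i \<noteq> j \<and>
             (A i k = A j k \<or>
              (A i k \<inter> (\<Union>l\<in>{1..p} - {k}. A j l) \<noteq> {} \<and>
               A j k \<inter> (\<Union>l\<in>{1..p} - {k}. A i l) \<noteq> {}))"
  shows "card J \<le> r ^ p"
proof -
  \<comment> \<open>The induction counts prefixes, that is, the distinct choices of the first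
    \<open>n\<close> parts; each extends in at most \<open>r\<close> ways.\<close>
  have "card ((\<lambda>j. restrict (A j) {1..n}) ` J) \<le> r ^ n" if "n \<le> p" for n
    using that
  proof (induction n)
    case 0
    \<comment> \<open>Every restriction to the empty range is the same constant function, so there
      is at most one empty prefix.\<close>
    have "card ((\<lambda>j. restrict (A j) {1..0}) ` J) \<le> card {\<lambda>_::nat. undefined :: 'a set}"
      by (intro card_mono) auto
    then show ?case by (simp add: restrict_def)
  next
    case (Suc n)
    let ?f = "\<lambda>j. restrict (A j) {1..n}" and ?h = "\<lambda>j. A j (Suc n)"
    have "card (?h ` {i\<in>J. ?f i = ?f j}) \<le> r" for j
    proof (rule ccontr)
      assume "\<not> ?thesis"
      then have "Suc r \<le> card (?h ` {i\<in>J. ?f i = ?f j})"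
        by simp
      then obtain C where C: "C \<subseteq> ?h ` {i\<in>J. ?f i = ?f j}" "card C = Suc r"
        by (meson obtain_subset_with_card_n)
      \<comment> \<open>One index is chosen for each of \<open>r + 1\<close> different continuations
        of the same prefix; injectivity of \<open>?h\<close> on \<open>I\<close> excludes the
        equality alternative of \<open>cross\<close>.\<close>
      then obtain I where I: "I \<subseteq> {i\<in>J. ?f i = ?f j}" "inj_on ?h I" "C = ?h ` I"
        by (auto simp: subset_image_inj)
      have "card I = r + 1"
        using C I by (simp add: card_image)
      moreover have "Suc n \<in> {1..p}" "I \<subseteq> J"
        using Suc.prems I by auto
      ultimately obtain i i' where i: "i \<in> I" "i' \<in> I" "i \<noteq> i'"
        "A i (Suc n) = A i' (Suc n) \<or>
          (A i (Suc n) \<inter> (\<Union>l\<in>{1..p} - {Suc n}. A i' l) \<noteq> {} \<and>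
           A i' (Suc n) \<inter> (\<Union>l\<in>{1..p} - {Suc n}. A i l) \<noteq> {})"
        using cross[of "Suc n" I] by blast
      have J: "i \<in> J" "i' \<in> J" and "?f i = ?f j" "?f i' = ?f j"
        using I(1) i(1,2) by blast+
      then have agree: "A i l = A i' l" if "l \<in> {1..<Suc n}" for l
        using that by (metis atLeastLessThanSuc_atLeastAtMost restrict_apply')
      have "A i (Suc n) \<noteq> A i' (Suc n)"
        using I(2) i by (auto dest: inj_onD)
      then show False
        using i(4) separates_not_crossing[OF sep[OF J(1)] sep[OF J(2)] _ _ \<open>Suc n \<in> {1..p}\<close> agree]
          wsc J sub \<open>Suc n \<in> {1..p}\<close> unfolding weak_set_composition_def by blast
    qed
    then have *: "card ((\<lambda>j. (?f j, ?h j)) ` J) \<le> r ^ n * r"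
      using Suc.prems assms(1) by (intro card_image_Pair_le Suc.IH) simp_all
    \<comment> \<open>A longer prefix is determined by the shorter one and the next part, so there
      are no more of them than pairs.\<close>
    have "(\<lambda>j. restrict (A j) {1..Suc n}) ` J = (\<lambda>(g, B). g(Suc n := B)) ` (\<lambda>j. (?f j, ?h j)) ` J"
      unfolding image_image by (intro image_cong) (auto simp: fun_eq_iff restrict_def)
    then have "card ((\<lambda>j. restrict (A j) {1..Suc n}) ` J) \<le> card ((\<lambda>j. (?f j, ?h j)) ` J)"
      using assms(1) by (simp add: card_image_le)
    also note *
    finally show ?case by (simp only: power_Suc2)
  qed
  \<comment> \<open>For \<open>n = p\<close>, injectivity turns the number of prefixes into the
    number of indices.\<close>
  from this[of p] inj show ?thesis
    by (simp add: card_image)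
qed

section \<open>Averaging over all orders of the ground set\<close>

theorem theorem2p5:
  fixes p r m :: nat and A :: "nat \<Rightarrow> nat \<Rightarrow> 'a set"
  assumes "p \<ge> 2" and "r \<ge> 1"
    and "\<And>j. j \<in> {1..m} \<Longrightarrow> weak_set_composition p (A j)"
    and "inj_on (\<lambda>j. restrict (A j) {1..p}) {1..m}"
    and "\<And>k I. k \<in> {1..p} \<Longrightarrow> I \<subseteq> {1..m} \<Longrightarrow> card I = r + 1 \<Longrightarrow>
           \<exists>i\<in>I. \<exists>j\<in>I. i \<noteq> j \<and>
             (A i k = A j k \<or>
              (A i k \<inter> (\<Union>l\<in>{1..p} - {k}. A j l) \<noteq> {} \<and>
               A j k \<inter> (\<Union>l\<in>{1..p} - {k}. A i l) \<noteq> {}))"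
  shows "(\<Sum>j=1..m. 1 / multinomial p (\<lambda>k. card (A j k))) \<le> real r ^ p"
proof -
  define S where "S = (\<Union>j\<in>{1..m}. \<Union>k\<in>{1..p}. A j k)"
  have S: "finite S"
    using assms(3) by (auto simp: S_def weak_set_composition_def)
  let ?P = "permutations_of_set S"
  have weight: "1 / multinomial p (\<lambda>k. card (A j k)) =
      real (card (separating_orders p (A j) S)) / fact (card S)" if "j \<in> {1..m}" for j
  proof -
    have "A j k \<inter> S = A j k" if "k \<in> {1..p}" for k
      using that \<open>j \<in> {1..m}\<close> unfolding S_def by blast
    then have "1 / multinomial p (\<lambda>k. card (A j k)) = part_weight p (A j) S"
      by (simp add: multinomial_def part_weight_def)
    then show ?thesis
      using card_separating_orders[OF S] assms(3)[OF that] by (simp add: weak_set_composition_def)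
  qed
  \<comment> \<open>Pairs of an index and an order separating its composition are counted in two
    ways.\<close>
  have "(\<Sum>j=1..m. card (separating_orders p (A j) S)) =
      (\<Sum>xs\<in>?P. card {j\<in>{1..m}. separates p (A j) xs})"
    unfolding separating_orders_def by (rule sum_multicount_gen[symmetric]) auto
  also have "\<dots> \<le> (\<Sum>xs\<in>?P. r ^ p)"
  proof (intro sum_mono card_separated_le[where A = A and xs = xs for xs])
    fix xs j k assume "xs \<in> ?P" "j \<in> {j\<in>{1..m}. separates p (A j) xs}" "k \<in> {1..p}"
    then show "A j k \<subseteq> set xs"
      unfolding S_def permutations_of_set_def by blast
  next
    fix xs k I assume "k \<in> {1..p}" "I \<subseteq> {j\<in>{1..m}. separates p (A j) xs}" "card I = r + 1"
    then show "\<exists>i\<in>I. \<exists>j\<in>I. i \<noteq> j \<and>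
             (A i k = A j k \<or>
              (A i k \<inter> (\<Union>l\<in>{1..p} - {k}. A j l) \<noteq> {} \<and>
               A j k \<inter> (\<Union>l\<in>{1..p} - {k}. A i l) \<noteq> {}))"
      by (intro assms(5)) auto
  next
    fix xs show "inj_on (\<lambda>j. restrict (A j) {1..p}) {j\<in>{1..m}. separates p (A j) xs}"
      by (rule inj_on_subset[OF assms(4)]) blast
  qed (use assms(3) in auto)
  also have "\<dots> = fact (card S) * r ^ p"
    using S by simp
  finally have "real (\<Sum>j=1..m. card (separating_orders p (A j) S)) \<le> fact (card S) * real r ^ p"
    by (metis of_nat_fact of_nat_le_iff of_nat_mult of_nat_power)
  then show ?thesis
    by (simp add: weight flip: sum_divide_distrib) (simp add: divide_simps mult.commute)
qed

end
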